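(* Let $X$ be a complete metric space, let $\varphi_1,\varphi_2\colon X\to\mathbb{R}_\infty$ be lower semicontinuous, let $\bar x\in\operatorname{dom}\varphi_1\cap\operatorname{dom}\varphi_2$, $\varepsilon>0$ and $\delta>0$. Suppose that $\bar x$ is a quasiuniform $\varepsilon$-minimum of $\varphi_1+\varphi_2$ on $B_\delta(\bar x)$, and that $\varphi_1$ and $\varphi_2$ are bounded from below on $B_\delta(\bar x)$. Then for any sufficiently large $\rho\in(0,\delta)$ (i.e. for all $\rho\in(\rho_0,\delta)$ with some $\rho_0\in(0,\delta)$) and any $\eta>0$, there exist a number $\gamma>0$ and points $\hat x_1,\hat x_2\in X$ such that $$d((\hat x_1,\hat x_2),(\bar x,\bar x))<\rho,\qquad d(\hat x_1,\hat x_2)<\eta,\qquad \varphi_\gamma(\hat x_1,\hat x_2)\le(\varphi_1+\varphi_2)(\bar x),$$ $$\sup_{\substack{u_1,u_2\in\overline B_\rho(\bar x)\\ (u_1,u_2)\ne(\hat x_1,\hat x_2)}}\frac{\varphi_\gamma(\hat x_1,\hat x_2)-\varphi_\gamma(u_1,u_2)}{d((u_1,u_2),(\hat x_1,\hat x_2))}<\frac{2\varepsilon}{\delta},$$ where $\varphi_\gamma(u_1,u_2):=\varphi_1(u_1)+\varphi_2(u_2)+\gamma\,d(u_1,u_2)$ for all $u_1,u_2\in X$.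
   Context: $\mathbb{R}_\infty:=\mathbb{R}\cup\{+\infty\}$, and $\operatorname{dom}\varphi:=\{x\mid\varphi(x)<+\infty\}$. $B_\delta(x)$ and $\overline B_\delta(x)$ are the open and closed balls with center $x$ and radius $\delta$. The product $X\times X$ carries the maximum distance $d((u_1,u_2),(v_1,v_2))=\max\{d(u_1,v_1),d(u_2,v_2)\}$. Convention: $\inf\emptyset=+\infty$; a quotient in the supremum equals $-\infty$ when $\varphi_\gamma(u_1,u_2)=+\infty$. A set $V\subset X$ is an essentially interior subset of $U\subset X$ if there is $\rho>0$ such that $\bigcup_{x\in V}B_\rho(x)\subset U$; $EI(U)$ is the collection of all essentially interior subsets of $U$ (it contains $\emptyset$). For $U\subset X$ put $$\Lambda_U^\circ(\varphi_1,\varphi_2):=\liminf_{d(x_1,x_2)\to0;\;x_1,x_2\in U}(\varphi_1(x_1)+\varphi_2(x_2)):=\lim_{\eta\downarrow0}\ \inf_{x_1,x_2\in U,\ d(x_1,x_2)<\eta}(\varphi_1(x_1)+\varphi_2(x_2)),$$ $$\Lambda_U^\dagger(\varphi_1,\varphi_2):=\inf_{V\in EI(U)}\Lambda_V^\circ(\varphi_1,\varphi_2).$$ The point $\bar x$ is a quasiuniform $\varepsilon$-minimum of $\varphi_1+\varphi_2$ on $B_\delta(\bar x)$ if $(\varphi_1+\varphi_2)(\bar x)<\Lambda^\dagger_{B_\delta(\bar x)}(\varphi_1,\varphi_2)+\varepsilon$. *)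

theory Defs
  imports "HOL-Analysis.Analysis"
begin

text \<open>
  Functions with values in the reals extended by plus infinity are functions into \<^typ>\<open>ereal\<close>
  that never take the value minus infinity.
\<close>

definition R_infty_valued :: "('a \<Rightarrow> ereal) \<Rightarrow> bool" where
  "R_infty_valued f \<longleftrightarrow> (\<forall>x. f x \<noteq> -\<infinity>)"

definition eff_dom :: "('a \<Rightarrow> ereal) \<Rightarrow> 'a set" where
  "eff_dom f = {x. f x < \<infinity>}"

definition lower_semicontinuous :: "('a::topological_space \<Rightarrow> ereal) \<Rightarrow> bool" where
  "lower_semicontinuous f \<longleftrightarrow> (\<forall>x. f x \<le> Liminf (at x) f)"

definition bounded_from_below_on :: "'a set \<Rightarrow> ('a \<Rightarrow> ereal) \<Rightarrow> bool" where
  "bounded_from_below_on U f \<longleftrightarrow> (\<exists>m::real. \<forall>x\<in>U. ereal m \<le> f x)"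

text \<open>The library's \<^const>\<open>dist\<close> on a product type is Euclidean; the maximum distance is needed here.\<close>

definition max_dist :: "'a::metric_space \<times> 'a \<Rightarrow> 'a \<times> 'a \<Rightarrow> real" where
  "max_dist u v = max (dist (fst u) (fst v)) (dist (snd u) (snd v))"

definition essentially_interior :: "'a::metric_space set \<Rightarrow> 'a set \<Rightarrow> bool" where
  "essentially_interior V U \<longleftrightarrow> (\<exists>\<rho>>0. (\<Union>x\<in>V. ball x \<rho>) \<subseteq> U)"

definition EI :: "'a::metric_space set \<Rightarrow> 'a set set" where
  "EI U = {V. essentially_interior V U}"

text \<open>
  The infimum is taken in \<^typ>\<open>ereal\<close>, so it is plus infinity over the empty set.
\<close>

definition near_inf ::
  "'a::metric_space set \<Rightarrow> ('a \<Rightarrow> ereal) \<Rightarrow> ('a \<Rightarrow> ereal) \<Rightarrow> real \<Rightarrow> ereal" where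
  "near_inf U f g \<eta> =
     Inf {f x1 + g x2 | x1 x2. x1 \<in> U \<and> x2 \<in> U \<and> dist x1 x2 < \<eta>}"

definition Lambda_circ ::
  "'a::metric_space set \<Rightarrow> ('a \<Rightarrow> ereal) \<Rightarrow> ('a \<Rightarrow> ereal) \<Rightarrow> ereal" where
  "Lambda_circ U f g = Lim (at_right 0) (near_inf U f g)"

definition Lambda_dagger ::
  "'a::metric_space set \<Rightarrow> ('a \<Rightarrow> ereal) \<Rightarrow> ('a \<Rightarrow> ereal) \<Rightarrow> ereal" where
  "Lambda_dagger U f g = (INF V\<in>EI U. Lambda_circ V f g)"

text \<open>The limit above always exists, so that \<^const>\<open>Lim\<close> is meaningful.\<close>

lemma near_inf_antimono: "\<eta> \<le> \<eta>' \<Longrightarrow> near_inf U f g \<eta>' \<le> near_inf U f g \<eta>"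
  unfolding near_inf_def by (rule Inf_superset_mono) force

lemma near_inf_tendsto_SUP:
  "(near_inf U f g \<longlongrightarrow> (SUP \<eta>\<in>{0<..}. near_inf U f g \<eta>)) (at_right 0)"
proof (rule order_tendstoI)
  fix a assume "a < (SUP \<eta>\<in>{0<..}. near_inf U f g \<eta>)"
  then obtain e where e: "e > 0" "a < near_inf U f g e"
    by (auto simp: less_SUP_iff)
  have "eventually (\<lambda>\<eta>. \<eta> \<in> {0<..<e}) (at_right 0)"
    using e(1) by (rule eventually_at_right_real)
  then show "eventually (\<lambda>\<eta>. a < near_inf U f g \<eta>) (at_right 0)"
  proof (rule eventually_mono)
    fix \<eta> assume "\<eta> \<in> {0<..<e}"
    then have "near_inf U f g e \<le> near_inf U f g \<eta>" by (intro near_inf_antimono) simp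
    with e(2) show "a < near_inf U f g \<eta>" by (rule less_le_trans)
  qed
next
  fix a assume a: "(SUP \<eta>\<in>{0<..}. near_inf U f g \<eta>) < a"
  have "eventually (\<lambda>\<eta>. \<eta> > 0) (at_right (0::real))"
    by (simp add: eventually_at_right_less)
  then show "eventually (\<lambda>\<eta>. near_inf U f g \<eta> < a) (at_right 0)"
  proof (rule eventually_mono)
    fix \<eta> :: real assume "\<eta> > 0"
    then have "near_inf U f g \<eta> \<le> (SUP \<eta>\<in>{0<..}. near_inf U f g \<eta>)" by (intro SUP_upper) simp
    then show "near_inf U f g \<eta> < a" using a by (rule le_less_trans)
  qed
qed

lemma Lambda_circ_eq_SUP: "Lambda_circ U f g = (SUP \<eta>\<in>{0<..}. near_inf U f g \<eta>)"
  unfolding Lambda_circ_def by (intro tendsto_Lim near_inf_tendsto_SUP) simp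

definition quasiuniform_eps_min ::
  "('a::metric_space \<Rightarrow> ereal) \<Rightarrow> ('a \<Rightarrow> ereal) \<Rightarrow> 'a \<Rightarrow> real \<Rightarrow> real \<Rightarrow> bool" where
  "quasiuniform_eps_min f g xb \<epsilon> \<delta> \<longleftrightarrow>
     f xb + g xb < Lambda_dagger (ball xb \<delta>) f g + ereal \<epsilon>"

definition penalized_sum ::
  "('a::metric_space \<Rightarrow> ereal) \<Rightarrow> ('a \<Rightarrow> ereal) \<Rightarrow> real \<Rightarrow> 'a \<times> 'a \<Rightarrow> ereal" where
  "penalized_sum f g \<gamma> u = f (fst u) + g (snd u) + ereal (\<gamma> * dist (fst u) (snd u))"

end

theory Submission
  imports Defs
begin

text \<open>
  Put \<open>\<kappa> = \<epsilon> / \<rho>\<close> and work on the set \<open>S\<close> of pairs of points of the closed ball of radius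
  \<open>\<rho> < \<delta>\<close>. This ball is an essentially interior subset of \<open>ball xb \<delta>\<close>, so
  quasiuniform \<open>\<epsilon>\<close>-minimality says that \<open>\<phi>1 x1 + \<phi>2 x2\<close> exceeds
  \<open>F - \<epsilon>\<close>, with \<open>F = \<phi>1 xb + \<phi>2 xb\<close>, for all pairs in \<open>S\<close> whose
  two points are sufficiently close to each other (\<open>quasiuniform_eps_min_cball\<close>). On the other
  pairs the lower bounds of \<open>\<phi>1\<close> and \<open>\<phi>2\<close> allow a large penalty \<open>\<gamma>\<close> to
  push the penalized sum above \<open>F\<close>.

  Since \<open>(xb, xb)\<close> has penalized value \<open>F\<close>, the Ekeland variational principle with slope
  \<open>\<kappa>\<close> on \<open>S\<close> gives a pair \<open>x\<close> whose value is at most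
  \<open>F - \<kappa> * max_dist (xb, xb) x\<close> and which is a strict minimizer on \<open>S\<close> of the
  penalized sum plus \<open>\<kappa>\<close> times the distance to \<open>x\<close>. The value is at most \<open>F\<close>, so
  the two components of \<open>x\<close> are close to each other; hence the value also exceeds
  \<open>F - \<epsilon>\<close>, and the distance from \<open>(xb, xb)\<close> to \<open>x\<close> is less than
  \<open>\<epsilon> / \<kappa> = \<rho>\<close>. The difference quotients at \<open>x\<close> are at most
  \<open>\<epsilon> / \<rho>\<close>, which is less than \<open>2 * \<epsilon> / \<delta>\<close> as soon as
  \<open>\<rho> > \<delta> / 2\<close>; therefore \<open>\<delta> / 2\<close> serves as the threshold for \<open>\<rho>\<close>.
\<close>

section \<open>Lower semicontinuity\<close>

text \<open>
  The punctured filter of the definition can be replaced by the full neighbourhood filter, because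
  \<open>a < f y\<close> is assumed at the point \<open>y = x\<close> itself; full neighbourhood filters are
  preserved by continuous maps, also by those that are locally constant.
\<close>

lemma lower_semicontinuous_iff:
  "lower_semicontinuous f \<longleftrightarrow> (\<forall>x a. a < f x \<longrightarrow> eventually (\<lambda>y. a < f y) (nhds x))"
  unfolding lower_semicontinuous_def le_Liminf_iff eventually_nhds_conv_at by blast

lemma lower_semicontinuous_compose:
  assumes "lower_semicontinuous f" and "continuous_on UNIV h"
  shows "lower_semicontinuous (\<lambda>x. f (h x))"
  unfolding lower_semicontinuous_iff
proof (intro allI impI)
  fix x a assume "a < f (h x)"
  then have "eventually (\<lambda>y. a < f y) (nhds (h x))"
    using assms(1) by (simp add: lower_semicontinuous_iff)
  moreover have "filterlim h (nhds (h x)) (nhds x)"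
    using continuous_on_tendsto_compose[OF assms(2) filterlim_ident] by simp
  ultimately show "eventually (\<lambda>y. a < f (h y)) (nhds x)"
    by (rule eventually_compose_filterlim)
qed

lemma lower_semicontinuous_ereal_continuous:
  assumes "continuous_on UNIV h"
  shows "lower_semicontinuous (\<lambda>x. ereal (h x))"
  unfolding lower_semicontinuous_iff
proof (intro allI impI)
  fix x a assume a: "a < ereal (h x)"
  have "filterlim h (nhds (h x)) (nhds x)"
    using continuous_on_tendsto_compose[OF assms filterlim_ident] by simp
  then have "((\<lambda>y. ereal (h y)) \<longlongrightarrow> ereal (h x)) (nhds x)"
    by simp
  then show "eventually (\<lambda>y. a < ereal (h y)) (nhds x)"
    using a by (rule order_tendstoD)
qed

text \<open>
  Any number below a sum can be distributed over the two summands with some room left in each. This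
  is the pointwise content of the fact that lower semicontinuity passes to sums; it fails if one
  summand is \<open>-\<infinity>\<close> and the other \<open>\<infinity>\<close>.
\<close>

lemma less_add_ereal_split:
  fixes s t a :: ereal
  assumes "a < s + t" "s \<noteq> -\<infinity>" "t \<noteq> -\<infinity>"
  obtains b c :: real where "ereal b < s" "ereal c < t" "a \<le> ereal (b + c)"
proof (cases a)
  case PInf
  then show ?thesis using assms by simp
next
  case MInf
  obtain b c where "ereal b < s" "ereal c < t"
    using assms ereal_dense2[of "-\<infinity>" s] ereal_dense2[of "-\<infinity>" t] by auto
  then show ?thesis using that MInf by simp
next
  case (real r)
  have "a - t < s"
    using assms real by (cases t; cases s) (auto simp: algebra_simps)
  then obtain b where b: "a - t < ereal b" "ereal b < s"
    using ereal_dense2 by blast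
  have "a - ereal b < t"
    using b assms real by (cases t) (auto simp: algebra_simps)
  then obtain c where c: "a - ereal b < ereal c" "ereal c < t"
    using ereal_dense2 by blast
  have "a \<le> ereal (b + c)"
    using c(1) real by (auto simp: algebra_simps)
  then show ?thesis using that b c by blast
qed

lemma lower_semicontinuous_add:
  assumes "lower_semicontinuous f" "lower_semicontinuous g"
    and "R_infty_valued f" "R_infty_valued g"
  shows "lower_semicontinuous (\<lambda>x. f x + g x)"
  unfolding lower_semicontinuous_iff
proof (intro allI impI)
  fix x a assume "a < f x + g x"
  then obtain b c :: real where bc: "ereal b < f x" "ereal c < g x" "a \<le> ereal (b + c)"
    using less_add_ereal_split assms(3,4) unfolding R_infty_valued_def by metis
  have "eventually (\<lambda>y. ereal b < f y) (nhds x)" "eventually (\<lambda>y. ereal c < g y) (nhds x)"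
    using bc assms(1,2) by (simp_all add: lower_semicontinuous_iff)
  then show "eventually (\<lambda>y. a < f y + g y) (nhds x)"
  proof eventually_elim
    case (elim y)
    have "ereal b + ereal c < f y + g y"
      using elim by (rule ereal_add_strict_mono2)
    then show ?case using bc(3) by simp
  qed
qed

lemma lower_semicontinuous_closed_sublevel:
  assumes "lower_semicontinuous f"
  shows "closed {x. f x \<le> a}"
proof -
  have "open {x. a < f x}"
    unfolding open_subopen[of "{x. a < f x}"]
    using assms by (fastforce simp: lower_semicontinuous_iff eventually_nhds)
  moreover have "- {x. a < f x} = {x. f x \<le> a}"
    by auto
  ultimately show ?thesis by (metis closed_Compl)
qed

section \<open>The Ekeland variational principle\<close>

text \<open>
  For \<open>x\<close> in \<open>S\<close> let \<open>T x\<close> be the set of all \<open>y\<close> in \<open>S\<close> that improve on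
  \<open>x\<close> at rate at least \<open>\<kappa>\<close>. The relation \<open>y \<in> T x\<close> is a preorder by the triangle
  inequality, and \<open>T x\<close> is closed by lower semicontinuity. Moving from \<open>x\<close> to an
  almost minimal point \<open>y\<close> of \<open>T x\<close> makes \<open>T y\<close> small: each of its points improves
  on \<open>y\<close> only a little, hence is close to \<open>y\<close>. Iterating yields nested closed sets whose
  diameters tend to 0, and their common point \<open>a\<close> has \<open>T a = {a}\<close>, which is the claim.

  The distance \<open>D\<close> in which the slope is measured is kept apart from the metric of the type: on
  a product type the latter is Euclidean, while the slope is needed in the maximum distance.
\<close>

theorem Ekeland_variational_principle:
  fixes f :: "'b::complete_space \<Rightarrow> ereal" and D :: "'b \<Rightarrow> 'b \<Rightarrow> real"
  assumes D_refl: "\<And>x. D x x = 0"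
    and D_tri: "\<And>x y z. D x z \<le> D x y + D y z"
    and D_dist: "\<And>x y. dist x y \<le> C * D x y" and "C > 0"
    and D_cont: "\<And>x. continuous_on UNIV (D x)"
    and lsc: "lower_semicontinuous f" and fin: "R_infty_valued f"
    and "closed S" and bdd: "bounded_from_below_on S f"
    and "x0 \<in> S" and "f x0 < \<infinity>" and "\<kappa> > 0"
  obtains x where "x \<in> S" "f x + ereal (\<kappa> * D x0 x) \<le> f x0"
    "\<And>y. y \<in> S \<Longrightarrow> y \<noteq> x \<Longrightarrow> f x < f y + ereal (\<kappa> * D x y)"
proof -
  define T where "T x = {y \<in> S. f y + ereal (\<kappa> * D x y) \<le> f x}" for x
  obtain m :: real where m: "\<And>x. x \<in> S \<Longrightarrow> ereal m \<le> f x"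
    using bdd by (auto simp: bounded_from_below_on_def)
  have not_MInf: "f x \<noteq> -\<infinity>" for x
    using fin by (simp add: R_infty_valued_def)
  have D_nonneg: "0 \<le> D x y" for x y
    using order_trans[OF zero_le_dist D_dist] \<open>C > 0\<close> by (simp add: zero_le_mult_iff)
  have T_refl: "x \<in> T x" if "x \<in> S" for x
    using that by (simp add: T_def D_refl)
  have T_le: "f y \<le> f x" if "y \<in> T x" for x y
  proof -
    have "f y + 0 \<le> f y + ereal (\<kappa> * D x y)"
      using D_nonneg[of x y] \<open>\<kappa> > 0\<close> by (intro add_left_mono) simp
    also have "\<dots> \<le> f x"
      using that by (simp add: T_def)
    finally show ?thesis by simp
  qed
  have T_trans: "z \<in> T x" if "y \<in> T x" "z \<in> T y" for x y z
  proof -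
    have "\<kappa> * D x z \<le> \<kappa> * D y z + \<kappa> * D x y"
      using D_tri[of x z y] \<open>\<kappa> > 0\<close> by (simp flip: distrib_left add: add.commute)
    then have "f z + ereal (\<kappa> * D x z) \<le> f z + ereal (\<kappa> * D y z + \<kappa> * D x y)"
      by (intro add_left_mono) simp
    also have "\<dots> = (f z + ereal (\<kappa> * D y z)) + ereal (\<kappa> * D x y)"
      by (simp add: add.assoc flip: plus_ereal.simps(1))
    also have "\<dots> \<le> f y + ereal (\<kappa> * D x y)"
      using that(2) by (intro add_right_mono) (simp add: T_def)
    also have "\<dots> \<le> f x"
      using that(1) by (simp add: T_def)
    finally show ?thesis
      using that(2) by (simp add: T_def)
  qed
  have T_closed: "closed (T x)" for x
  proof -
    have "lower_semicontinuous (\<lambda>y. f y + ereal (\<kappa> * D x y))"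
      using lsc fin D_cont
      by (intro lower_semicontinuous_add lower_semicontinuous_ereal_continuous continuous_intros)
        (auto simp: R_infty_valued_def)
    then have "closed (S \<inter> {y. f y + ereal (\<kappa> * D x y) \<le> f x})"
      using \<open>closed S\<close> by (intro closed_Int lower_semicontinuous_closed_sublevel)
    then show ?thesis by (simp add: T_def Int_def)
  qed
  have near_min: "\<exists>y\<in>T x. \<forall>z\<in>T x. f y \<le> f z + ereal e" if "x \<in> S" "f x < \<infinity>" "e > 0" for x e
  proof -
    define I where "I = (INF z\<in>T x. f z)"
    have "ereal m \<le> I"
      unfolding I_def by (rule INF_greatest) (auto simp: T_def m)
    moreover have "I \<le> f x"
      unfolding I_def using T_refl[OF \<open>x \<in> S\<close>] by (rule INF_lower)
    ultimately obtain i where i: "I = ereal i"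
      using \<open>f x < \<infinity>\<close> by (cases I) auto
    have "I < ereal (i + e)"
      using \<open>e > 0\<close> by (simp add: i)
    then obtain y where y: "y \<in> T x" "f y < ereal (i + e)"
      unfolding I_def by (auto simp: INF_less_iff)
    have "f y \<le> f z + ereal e" if "z \<in> T x" for z
    proof -
      have "f y \<le> I + ereal e" using y(2) i by simp
      also have "I \<le> f z" unfolding I_def using that by (rule INF_lower)
      finally show ?thesis by (simp add: add_right_mono)
    qed
    with y(1) show ?thesis by blast
  qed
  \<comment> \<open>Membership in \<open>T x0\<close> is carried along because it keeps the values of \<open>f\<close> finite,
    which the choice of an almost minimal point requires.\<close>
  have "\<exists>s. \<forall>n. (s n \<in> T x0 \<and> (n = 0 \<longrightarrow> s n = x0)) \<and>
      (s (Suc n) \<in> T (s n) \<and> (\<forall>z\<in>T (s n). f (s (Suc n)) \<le> f z + ereal (inverse (Suc n))))"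
  proof (rule dependent_nat_choice)
    show "\<exists>x. x \<in> T x0 \<and> (0 = (0::nat) \<longrightarrow> x = x0)"
      using T_refl \<open>x0 \<in> S\<close> by blast
  next
    fix x and n :: nat
    assume x: "x \<in> T x0 \<and> (n = 0 \<longrightarrow> x = x0)"
    then have "f x < \<infinity>" "x \<in> S"
      using T_le[of x x0] \<open>f x0 < \<infinity>\<close> by (auto simp: T_def)
    then obtain y where "y \<in> T x" "\<forall>z\<in>T x. f y \<le> f z + ereal (inverse (Suc n))"
      using near_min[of x "inverse (Suc n)"] by auto
    then show "\<exists>y. (y \<in> T x0 \<and> (Suc n = 0 \<longrightarrow> y = x0)) \<and>
        y \<in> T x \<and> (\<forall>z\<in>T x. f y \<le> f z + ereal (inverse (Suc n)))"
      using x T_trans by blast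
  qed
  then obtain s where s0: "s 0 = x0" and s_in: "\<And>n. s n \<in> T x0"
    and s_step: "\<And>n. s (Suc n) \<in> T (s n)"
    and s_min: "\<And>n z. z \<in> T (s n) \<Longrightarrow> f (s (Suc n)) \<le> f z + ereal (inverse (Suc n))"
    by metis
  have near: "dist (s (Suc n)) y \<le> C * (inverse (Suc n) / \<kappa>)" if "y \<in> T (s (Suc n))" for n y
  proof -
    have "f y + ereal (\<kappa> * D (s (Suc n)) y) \<le> f (s (Suc n))"
      using that by (simp add: T_def)
    also have "\<dots> \<le> f y + ereal (inverse (Suc n))"
      using s_min T_trans[OF s_step that] by blast
    finally have *: "f y + ereal (\<kappa> * D (s (Suc n)) y) \<le> f y + ereal (inverse (Suc n))" .
    have "f y < \<infinity>"
      using T_le[OF T_trans[OF s_in that]] \<open>f x0 < \<infinity>\<close> by auto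
    then have "\<kappa> * D (s (Suc n)) y \<le> inverse (Suc n)"
      using * not_MInf[of y] by (cases "f y") auto
    then have "D (s (Suc n)) y \<le> inverse (Suc n) / \<kappa>"
      using \<open>\<kappa> > 0\<close> by (simp only: pos_le_divide_eq mult.commute)
    then have "C * D (s (Suc n)) y \<le> C * (inverse (Suc n) / \<kappa>)"
      using \<open>C > 0\<close> by (intro mult_left_mono) auto
    then show ?thesis using D_dist[of "s (Suc n)" y] by linarith
  qed
  have "\<exists>a. \<Inter> (range (\<lambda>n. T (s n))) = {a}"
  proof (rule decreasing_closed_nest_sing)
    show "closed (T (s n))" for n by (rule T_closed)
    show "T (s n) \<noteq> {}" for n using s_step by blast
    show "T (s n) \<subseteq> T (s k)" if "k \<le> n" for k n
      using that by (rule lift_Suc_antimono_le[of "\<lambda>n. T (s n)", rotated])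
        (use s_step T_trans in blast)
    show "\<exists>n. \<forall>x\<in>T (s n). \<forall>y\<in>T (s n). dist x y < e" if "e > 0" for e
    proof -
      obtain n where n: "inverse (Suc n) < e * \<kappa> / (2 * C)"
        using reals_Archimedean[of "e * \<kappa> / (2 * C)"] \<open>e > 0\<close> \<open>\<kappa> > 0\<close> \<open>C > 0\<close> by auto
      then have "C / \<kappa> * inverse (Suc n) < C / \<kappa> * (e * \<kappa> / (2 * C))"
        using \<open>\<kappa> > 0\<close> \<open>C > 0\<close> by (intro mult_strict_left_mono) auto
      then have "C * (inverse (Suc n) / \<kappa>) < e / 2"
        using \<open>\<kappa> > 0\<close> \<open>C > 0\<close> by simp
      then have "dist (s (Suc n)) y < e / 2" if "y \<in> T (s (Suc n))" for y
        using near[OF that] by linarith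
      then have "\<forall>x\<in>T (s (Suc n)). \<forall>y\<in>T (s (Suc n)). dist x y < e"
        by (metis dist_commute dist_triangle_half_l)
      then show ?thesis by blast
    qed
  qed
  then obtain a where a: "\<Inter> (range (\<lambda>n. T (s n))) = {a}" by blast
  then have a_in: "a \<in> T (s n)" for n by blast
  show thesis
  proof (rule that)
    show "a \<in> S" using a_in[of 0] by (simp add: T_def)
    show "f a + ereal (\<kappa> * D x0 a) \<le> f x0" using a_in[of 0] by (simp add: T_def s0)
  next
    fix y assume y: "y \<in> S" "y \<noteq> a"
    have "y \<notin> T a"
    proof
      assume "y \<in> T a"
      then have "y \<in> \<Inter> (range (\<lambda>n. T (s n)))"
        using T_trans a_in by blast
      then show False using a y(2) by simp
    qed
    then show "f a < f y + ereal (\<kappa> * D a y)" using y(1) by (simp add: T_def)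
  qed
qed

section \<open>The maximum distance and the penalized sum\<close>

lemma max_dist_triangle: "max_dist u w \<le> max_dist u v + max_dist v w"
  using dist_triangle[of "fst u" "fst w" "fst v"] dist_triangle[of "snd u" "snd w" "snd v"]
  by (auto simp: max_dist_def)

lemma dist_le_max_dist: "dist u v \<le> 2 * max_dist u v"
proof -
  have "dist u v \<le> dist (fst u) (fst v) + dist (snd u) (snd v)"
    unfolding dist_prod_def by (rule sqrt_sum_squares_le_sum) auto
  then show ?thesis by (auto simp: max_dist_def)
qed

lemma max_dist_commute: "max_dist u v = max_dist v u"
  by (simp add: max_dist_def dist_commute)

lemma max_dist_pos: "u \<noteq> v \<Longrightarrow> 0 < max_dist u v"
  by (auto simp: max_dist_def less_max_iff_disj prod_eq_iff)

lemma continuous_on_max_dist: "continuous_on UNIV (max_dist u)"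
  unfolding max_dist_def[abs_def] by (intro continuous_intros)

lemma R_infty_valued_penalized_sum:
  assumes "R_infty_valued f" "R_infty_valued g"
  shows "R_infty_valued (penalized_sum f g \<gamma>)"
  using assms by (auto simp: R_infty_valued_def penalized_sum_def)

lemma lower_semicontinuous_penalized_sum:
  assumes "lower_semicontinuous f" "lower_semicontinuous g" "R_infty_valued f" "R_infty_valued g"
  shows "lower_semicontinuous (penalized_sum f g \<gamma>)"
  unfolding penalized_sum_def[abs_def] using assms
  by (intro lower_semicontinuous_add lower_semicontinuous_ereal_continuous
      lower_semicontinuous_compose[of f fst] lower_semicontinuous_compose[of g snd] continuous_intros)
    (auto simp: R_infty_valued_def)

text \<open>
  The gap \<open>\<delta> - \<rho>\<close> witnesses that the smaller ball is essentially interior. The strict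
  inequality for the limit as \<open>\<eta>\<close> tends to 0 is already attained at some positive
  \<open>\<eta>\<close>, since the limit is a supremum.
\<close>

lemma quasiuniform_eps_min_cball:
  assumes "quasiuniform_eps_min f g xb \<epsilon> \<delta>" and "\<rho> < \<delta>"
  obtains \<eta> where "\<eta> > 0"
    "\<And>x1 x2. x1 \<in> cball xb \<rho> \<Longrightarrow> x2 \<in> cball xb \<rho> \<Longrightarrow> dist x1 x2 < \<eta> \<Longrightarrow>
       f xb + g xb < f x1 + g x2 + ereal \<epsilon>"
proof -
  have "ball x (\<delta> - \<rho>) \<subseteq> ball xb \<delta>" if "x \<in> cball xb \<rho>" for x
  proof
    fix y assume "y \<in> ball x (\<delta> - \<rho>)"
    with that show "y \<in> ball xb \<delta>"
      using dist_triangle[of xb y x] by simp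
  qed
  then have "cball xb \<rho> \<in> EI (ball xb \<delta>)"
    using \<open>\<rho> < \<delta>\<close> unfolding EI_def essentially_interior_def
    by (intro CollectI exI[of _ "\<delta> - \<rho>"] conjI UN_least) simp_all
  then have "Lambda_dagger (ball xb \<delta>) f g \<le> Lambda_circ (cball xb \<rho>) f g"
    unfolding Lambda_dagger_def by (rule INF_lower)
  then have "f xb + g xb < Lambda_circ (cball xb \<rho>) f g + ereal \<epsilon>"
    using assms(1) unfolding quasiuniform_eps_min_def by (meson add_right_mono less_le_trans)
  then have "f xb + g xb - ereal \<epsilon> < (SUP \<eta>\<in>{0<..}. near_inf (cball xb \<rho>) f g \<eta>)"
    by (simp add: Lambda_circ_eq_SUP ereal_minus_less)
  then obtain \<eta> where \<eta>: "\<eta> > 0" "f xb + g xb - ereal \<epsilon> < near_inf (cball xb \<rho>) f g \<eta>"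
    by (auto simp: less_SUP_iff)
  show thesis
  proof (rule that[OF \<eta>(1)])
    fix x1 x2 assume "x1 \<in> cball xb \<rho>" "x2 \<in> cball xb \<rho>" "dist x1 x2 < \<eta>"
    then have "near_inf (cball xb \<rho>) f g \<eta> \<le> f x1 + g x2"
      unfolding near_inf_def by (intro Inf_lower) blast
    with \<eta>(2) have "f xb + g xb - ereal \<epsilon> < f x1 + g x2"
      by (rule less_le_trans)
    then show "f xb + g xb < f x1 + g x2 + ereal \<epsilon>"
      by (simp add: ereal_minus_less)
  qed
qed

section \<open>Approximate minimizers of the penalized sum\<close>

theorem theorem6p6:
  fixes \<phi>1 \<phi>2 :: "'a::complete_space \<Rightarrow> ereal" and xb :: 'a and \<epsilon> \<delta> :: real
  assumes "R_infty_valued \<phi>1" and "R_infty_valued \<phi>2"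
    and "lower_semicontinuous \<phi>1" and "lower_semicontinuous \<phi>2"
    and "xb \<in> eff_dom \<phi>1 \<inter> eff_dom \<phi>2"
    and "\<epsilon> > 0" and "\<delta> > 0"
    and "quasiuniform_eps_min \<phi>1 \<phi>2 xb \<epsilon> \<delta>"
    and "bounded_from_below_on (ball xb \<delta>) \<phi>1"
    and "bounded_from_below_on (ball xb \<delta>) \<phi>2"
  shows "\<exists>\<rho>0\<in>{0<..<\<delta>}. \<forall>\<rho>\<in>{\<rho>0<..<\<delta>}. \<forall>\<eta>>0. \<exists>\<gamma>>0. \<exists>xh1 xh2.
           max_dist (xh1, xh2) (xb, xb) < \<rho> \<and>
           dist xh1 xh2 < \<eta> \<and>
           penalized_sum \<phi>1 \<phi>2 \<gamma> (xh1, xh2) \<le> \<phi>1 xb + \<phi>2 xb \<and>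
           (SUP u\<in>{(u1, u2). u1 \<in> cball xb \<rho> \<and> u2 \<in> cball xb \<rho> \<and> (u1, u2) \<noteq> (xh1, xh2)}.
              (penalized_sum \<phi>1 \<phi>2 \<gamma> (xh1, xh2) - penalized_sum \<phi>1 \<phi>2 \<gamma> u)
                / ereal (max_dist u (xh1, xh2)))
             < ereal (2 * \<epsilon> / \<delta>)"
proof (intro bexI[of _ "\<delta> / 2"] ballI allI impI)
  show "\<delta> / 2 \<in> {0<..<\<delta>}" using \<open>\<delta> > 0\<close> by simp
  fix \<rho> \<eta> :: real assume "\<rho> \<in> {\<delta> / 2<..<\<delta>}" and "\<eta> > 0"
  then have \<rho>: "\<delta> / 2 < \<rho>" "\<rho> < \<delta>" "\<rho> > 0" using \<open>\<delta> > 0\<close> by auto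
  obtain m1 m2 :: real
    where m1: "\<And>x. x \<in> ball xb \<delta> \<Longrightarrow> ereal m1 \<le> \<phi>1 x"
      and m2: "\<And>x. x \<in> ball xb \<delta> \<Longrightarrow> ereal m2 \<le> \<phi>2 x"
    using assms(9,10) unfolding bounded_from_below_on_def by metis
  obtain F where F: "\<phi>1 xb + \<phi>2 xb = ereal F"
    using assms(1,2,5) by (cases "\<phi>1 xb"; cases "\<phi>2 xb") (auto simp: eff_dom_def R_infty_valued_def)
  obtain \<eta>0 where \<eta>0: "\<eta>0 > 0" and near: "\<And>x1 x2. x1 \<in> cball xb \<rho> \<Longrightarrow> x2 \<in> cball xb \<rho> \<Longrightarrow>
      dist x1 x2 < \<eta>0 \<Longrightarrow> ereal F < \<phi>1 x1 + \<phi>2 x2 + ereal \<epsilon>"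
    using quasiuniform_eps_min_cball[OF assms(8) \<rho>(2)] unfolding F by metis
  define \<eta>1 where "\<eta>1 = min \<eta> \<eta>0"
  have "\<eta>1 > 0" using \<eta>0 \<open>\<eta> > 0\<close> by (simp add: \<eta>1_def)
  \<comment> \<open>With this penalty, a pair in \<open>?S\<close> at mutual distance at least \<open>\<eta>1\<close> has penalized
    value at least \<open>m1 + m2 + \<gamma> * \<eta>1 > F\<close>.\<close>
  define \<gamma> where "\<gamma> = (\<bar>F - m1 - m2\<bar> + 1) / \<eta>1"
  define \<kappa> where "\<kappa> = \<epsilon> / \<rho>"
  have "\<gamma> > 0" using \<open>\<eta>1 > 0\<close> by (simp add: \<gamma>_def)
  have "\<kappa> > 0" using \<rho> \<open>\<epsilon> > 0\<close> by (simp add: \<kappa>_def)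
  let ?P = "penalized_sum \<phi>1 \<phi>2 \<gamma>" and ?S = "cball xb \<rho> \<times> cball xb \<rho>"
  have P_lower: "ereal (m1 + m2 + \<gamma> * dist (fst u) (snd u)) \<le> ?P u" if "u \<in> ?S" for u
  proof -
    have "ereal m1 + ereal m2 \<le> \<phi>1 (fst u) + \<phi>2 (snd u)"
      using that \<rho> by (intro add_mono m1 m2) auto
    then show ?thesis
      unfolding penalized_sum_def plus_ereal.simps(1)[symmetric] by (rule add_right_mono)
  qed
  have bdd: "bounded_from_below_on ?S ?P"
    unfolding bounded_from_below_on_def
  proof (intro exI ballI)
    fix u assume "u \<in> ?S"
    have "ereal (m1 + m2) \<le> ereal (m1 + m2 + \<gamma> * dist (fst u) (snd u))"
      using \<open>\<gamma> > 0\<close> by simp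
    also have "\<dots> \<le> ?P u" by (rule P_lower) fact
    finally show "ereal (m1 + m2) \<le> ?P u" .
  qed
  have P_not_MInf: "?P u \<noteq> -\<infinity>" for u
    using R_infty_valued_penalized_sum[OF assms(1,2), of \<gamma>] unfolding R_infty_valued_def by blast
  have P_start: "?P (xb, xb) = ereal F"
    by (simp add: penalized_sum_def F)
  obtain x where x: "x \<in> ?S" "?P x + ereal (\<kappa> * max_dist (xb, xb) x) \<le> ?P (xb, xb)"
    and x_min: "\<And>u. u \<in> ?S \<Longrightarrow> u \<noteq> x \<Longrightarrow> ?P x < ?P u + ereal (\<kappa> * max_dist x u)"
  proof (rule Ekeland_variational_principle[of max_dist 2 ?P ?S "(xb, xb)" \<kappa>])
    show "max_dist u u = 0" for u :: "'a \<times> 'a" by (simp add: max_dist_def)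
    show "closed ?S" by (intro closed_Times closed_cball)
    show "(xb, xb) \<in> ?S" using \<rho> by simp
    show "?P (xb, xb) < \<infinity>" by (simp add: P_start)
  qed (use assms \<open>\<kappa> > 0\<close> bdd in \<open>auto intro: max_dist_triangle dist_le_max_dist
      continuous_on_max_dist lower_semicontinuous_penalized_sum R_infty_valued_penalized_sum\<close>)
  obtain x1 x2 where x12: "x = (x1, x2)" by (cases x)
  have dist_nonneg: "0 \<le> max_dist (xb, xb) x" by (simp add: max_dist_def le_max_iff_disj)
  obtain p where p: "?P x = ereal p"
    using x(2) P_not_MInf[of x] unfolding P_start by (cases "?P x") auto
  have pF: "p + \<kappa> * max_dist (xb, xb) x \<le> F"
    using x(2) by (simp add: p P_start)
  have "p \<le> F"
    using pF mult_nonneg_nonneg[OF less_imp_le[OF \<open>\<kappa> > 0\<close>] dist_nonneg] by linarith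
  have x_near: "dist x1 x2 < \<eta>1"
  proof (rule ccontr)
    assume "\<not> dist x1 x2 < \<eta>1"
    then have "\<gamma> * \<eta>1 \<le> \<gamma> * dist x1 x2" using \<open>\<gamma> > 0\<close> by simp
    moreover have "\<gamma> * \<eta>1 = \<bar>F - m1 - m2\<bar> + 1" using \<open>\<eta>1 > 0\<close> by (simp add: \<gamma>_def)
    moreover have "m1 + m2 + \<gamma> * dist x1 x2 \<le> p" using P_lower[OF x(1)] p by (simp add: x12)
    ultimately show False using \<open>p \<le> F\<close> by linarith
  qed
  have "ereal F < \<phi>1 x1 + \<phi>2 x2 + ereal \<epsilon>"
    using near[of x1 x2] x(1) x_near by (simp add: x12 \<eta>1_def)
  also have "\<dots> \<le> ?P x + ereal \<epsilon>"
  proof -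
    have "\<phi>1 x1 + \<phi>2 x2 + 0 \<le> ?P x"
      unfolding penalized_sum_def x12 using \<open>\<gamma> > 0\<close> by (intro add_mono) auto
    then show ?thesis by (simp add: add_right_mono)
  qed
  finally have "F < p + \<epsilon>" by (simp add: p)
  then have "\<kappa> * max_dist (xb, xb) x < \<epsilon>" using pF by linarith
  then have x_close: "max_dist (x1, x2) (xb, xb) < \<rho>"
    using \<rho>(3) \<open>\<epsilon> > 0\<close> by (simp add: x12 \<kappa>_def max_dist_commute field_simps)
  have slope: "(?P x - ?P u) / ereal (max_dist u x) \<le> ereal \<kappa>" if "u \<in> ?S" "u \<noteq> x" for u
  proof (cases "?P u")
    case (real q)
    then have "p < q + \<kappa> * max_dist u x"
      using x_min[OF that] by (simp add: p max_dist_commute)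
    then show ?thesis
      using max_dist_pos[OF that(2)] by (simp add: p real field_simps)
  next
    case PInf
    then show ?thesis using max_dist_pos[OF that(2)] by (simp add: p)
  next
    case MInf
    then show ?thesis using P_not_MInf by blast
  qed
  have "(SUP u\<in>{(u1, u2). u1 \<in> cball xb \<rho> \<and> u2 \<in> cball xb \<rho> \<and> (u1, u2) \<noteq> (x1, x2)}.
      (?P (x1, x2) - ?P u) / ereal (max_dist u (x1, x2))) \<le> ereal \<kappa>"
    using slope unfolding x12 by (intro SUP_least) auto
  also have "\<kappa> < 2 * \<epsilon> / \<delta>"
    using \<rho> \<open>\<epsilon> > 0\<close> \<open>\<delta> > 0\<close> by (simp add: \<kappa>_def field_simps)
  finally have "(SUP u\<in>{(u1, u2). u1 \<in> cball xb \<rho> \<and> u2 \<in> cball xb \<rho> \<and> (u1, u2) \<noteq> (x1, x2)}.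
      (?P (x1, x2) - ?P u) / ereal (max_dist u (x1, x2))) < ereal (2 * \<epsilon> / \<delta>)"
    by simp
  then show "\<exists>\<gamma>>0. \<exists>xh1 xh2.
           max_dist (xh1, xh2) (xb, xb) < \<rho> \<and>
           dist xh1 xh2 < \<eta> \<and>
           penalized_sum \<phi>1 \<phi>2 \<gamma> (xh1, xh2) \<le> \<phi>1 xb + \<phi>2 xb \<and>
           (SUP u\<in>{(u1, u2). u1 \<in> cball xb \<rho> \<and> u2 \<in> cball xb \<rho> \<and> (u1, u2) \<noteq> (xh1, xh2)}.
              (penalized_sum \<phi>1 \<phi>2 \<gamma> (xh1, xh2) - penalized_sum \<phi>1 \<phi>2 \<gamma> u)
                / ereal (max_dist u (xh1, xh2)))
             < ereal (2 * \<epsilon> / \<delta>)"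
    using \<open>\<gamma> > 0\<close> x_close x_near \<open>p \<le> F\<close> p
    by (intro exI[of _ \<gamma>] conjI exI[of _ x1] exI[of _ x2]) (auto simp: F x12 \<eta>1_def)
qed

end
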